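(* Let $\overline v>0$ and $\overline s=n\overline v$ with $n\in\mathbb{Z}_+$. Consider the infinite-horizon storage management problem, and suppose that the support of the price distribution function at all stages lies within an interval $[\lambda_{\min},\lambda_{\max}]\subseteq[0,\infty)$. Then: (1) All else held constant, the maximum over all possible price distributions of the long-term economic value of storage is given by $$\mathcal{V}_\infty=-\gamma^\ast=\frac{\overline v(\lambda_{\max}-\lambda_{\min})}{2}\,\frac{n}{n+1}=\frac{\lambda_{\max}-\lambda_{\min}}{2}\,\frac{\overline s\,\overline v}{\overline s+\overline v},$$ and it is attained when the prices are sampled from the two-point symmetric distribution with masses at the endpoints of the support: $P_\Lambda(\lambda_{\min})=P_\Lambda(\lambda_{\max})=1/2$ and $P_\Lambda(\lambda)=0$ otherwise. (2) Furthermore, the corresponding differential cost function satisfying the Bellman equation $$H^\ast(s)=\mathbf{E}\Big[\min_{v\in[\max(-s,-\overline v),\min(\overline v,\overline s-s)]}\lambda v+H^\ast(s+v)\Big]-\gamma^\ast$$ (with $\lambda$ distributed according to this symmetric two-point distribution and $\gamma^\ast$ as in (1)) is given by the piecewise linear convex function $$H^\ast(s)=-\frac{(i+1)\lambda_{\min}+(n-i)\lambda_{\max}}{n+1}\,s-\frac{i(i+1)(\lambda_{\max}-\lambda_{\min})\overline v}{2(n+1)},$$ where $s\in[i\overline v,(i+1)\overline v)$ and $i\in\{0,\dots,n-1\}$, and for the special case $s=\overline s$ one takes $i=n-1$. (3) Finally, for any two-point distribution with $P_\Lambda(\lambda_{\max})=a$, $P_\Lambda(\lambda_{\min})=1-a$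 and $P_\Lambda(\lambda)=0$ otherwise, $$\mathcal{V}_\infty=-\gamma^\ast=\overline v(\lambda_{\max}-\lambda_{\min})\,\frac{b(1+b+\cdots+b^{n-1})}{(b+1)(1+b+\cdots+b^n)},\qquad b=\frac{1-a}{a}.$$
   Context: Infinite-horizon storage management problem: the storage state evolves as $s_{k+1}=s_k+v_k$, $k=0,1,2,\dots$, with constraints $s_k\in[0,\overline s]$ and $v_k\in[-\overline v,\overline v]$. The prices $\lambda_k\ge0$ are exogenous and independently distributed across stages according to probability mass functions (which in the general model may differ from stage to stage), and $\lambda_k$ is revealed before $v_k$ is chosen. There is no penalty for storing energy up to capacity. Given a control policy $\pi_k:[0,\infty)^2\to[-\overline v,\overline v]$ with $v_k=\pi_k(s_k,\lambda_k)$, and starting from an arbitrary initial state $s$, the infinite-horizon average cost per stage is $$\gamma_\pi=\lim_{N\to\infty}\frac1N\,\mathbf{E}\Big[\sum_{k=0}^{N-1}\lambda_k v_k\ \Big|\ s_0=s\Big].$$ The infinite-horizon storage management problem is the optimization (minimization) of $\gamma_\pi$ over all feasible stationary policies; $\gamma^\ast$ denotes the associated optimal cost (independent of the initial state), and $\mathcal{V}_\infty=-\gamma^\ast$ is called the long-term expected economic value of storage. In (1)–(3), "sampled from" a distribution $P_\Lambda$ means that the price at every stage has probability mass function $P_\Lambda$. $\mathbb{Z}_+$ denotes the positive integers.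
   Formalization: In (1) prices have the same distribution at every stage: with stage-varying distributions, deterministic prices alternating between λ_min and λ_max would give the larger value v̄(λ_max−λ_min)/2. In (3) a>0 is assumed, since b is undefined at a=0. *)

theory Defs
  imports "HOL-Probability.Probability"
begin

text \<open>Infinite-horizon storage management.  \<open>P k\<close> is the probability mass function of the price
  at stage \<open>k\<close>, a policy maps (state, revealed price) to a control, and \<open>\<omega> k\<close> is the realised
  price at stage \<open>k\<close>.\<close>

definition feasible_controls :: "real \<Rightarrow> real \<Rightarrow> real \<Rightarrow> real set" where
  "feasible_controls vbar sbar s = {max (- s) (- vbar)..min vbar (sbar - s)}"

text \<open>Policies are functions from \<open>[0,\<infinity>)\<^sup>2\<close> to \<open>[-vbar, vbar]\<close>; feasibility additionally
  demands that the state never leaves \<open>[0, sbar]\<close>.\<close>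

definition feasible_policy :: "real \<Rightarrow> real \<Rightarrow> (real \<Rightarrow> real \<Rightarrow> real) \<Rightarrow> bool" where
  "feasible_policy vbar sbar \<pi> \<longleftrightarrow>
     (\<forall>s\<ge>0. \<forall>l\<ge>0. \<pi> s l \<in> {- vbar..vbar}) \<and>
     (\<forall>s\<in>{0..sbar}. \<forall>l\<ge>0. s + \<pi> s l \<in> {0..sbar})"

primrec storage_state :: "(real \<Rightarrow> real \<Rightarrow> real) \<Rightarrow> real \<Rightarrow> (nat \<Rightarrow> real) \<Rightarrow> nat \<Rightarrow> real" where
  "storage_state \<pi> s \<omega> 0 = s"
| "storage_state \<pi> s \<omega> (Suc k) =
     storage_state \<pi> s \<omega> k + \<pi> (storage_state \<pi> s \<omega> k) (\<omega> k)"

text \<open>The cost of the first \<open>N\<close> stages depends only on the first \<open>N\<close> prices, whose joint law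
  is the product mass function.  This law is discrete, so arbitrary policies are measurable.\<close>

definition expected_cost ::
  "(nat \<Rightarrow> real pmf) \<Rightarrow> (real \<Rightarrow> real \<Rightarrow> real) \<Rightarrow> real \<Rightarrow> nat \<Rightarrow> real" where
  "expected_cost P \<pi> s N =
     measure_pmf.expectation (Pi_pmf {..<N} 0 P)
       (\<lambda>\<omega>. \<Sum>k<N. \<omega> k * \<pi> (storage_state \<pi> s \<omega> k) (\<omega> k))"

definition has_average_cost ::
  "(nat \<Rightarrow> real pmf) \<Rightarrow> (real \<Rightarrow> real \<Rightarrow> real) \<Rightarrow> real \<Rightarrow> real \<Rightarrow> bool" where
  "has_average_cost P \<pi> s \<gamma> \<longleftrightarrow> (\<lambda>N. 1 / real N * expected_cost P \<pi> s N) \<longlonglongrightarrow> \<gamma>"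

text \<open>A stationary policy competes in the infimum exactly when its average cost (a limit)
  exists from the initial state \<open>s\<close>.\<close>

definition optimal_cost :: "real \<Rightarrow> real \<Rightarrow> (nat \<Rightarrow> real pmf) \<Rightarrow> real \<Rightarrow> real" where
  "optimal_cost vbar sbar P s =
     Inf {\<gamma>. \<exists>\<pi>. feasible_policy vbar sbar \<pi> \<and> has_average_cost P \<pi> s \<gamma>}"

definition storage_value :: "real \<Rightarrow> real \<Rightarrow> (nat \<Rightarrow> real pmf) \<Rightarrow> real \<Rightarrow> real" where
  "storage_value vbar sbar P s = - optimal_cost vbar sbar P s"

text \<open>The first clause says that the minimum over \<open>v\<close> is attained, so that the infimum in the
  second clause is a minimum.\<close>

definition bellman :: "real \<Rightarrow> real \<Rightarrow> real pmf \<Rightarrow> real \<Rightarrow> (real \<Rightarrow> real) \<Rightarrow> bool" where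
  "bellman vbar sbar P \<gamma> H \<longleftrightarrow>
     (\<forall>s\<in>{0..sbar}.
        (\<forall>l\<in>set_pmf P. \<exists>v\<in>feasible_controls vbar sbar s. \<forall>w\<in>feasible_controls vbar sbar s.
            l * v + H (s + v) \<le> l * w + H (s + w)) \<and>
        H s = measure_pmf.expectation P
                (\<lambda>l. INF v\<in>feasible_controls vbar sbar s. l * v + H (s + v)) - \<gamma>)"

definition two_point_pmf :: "real \<Rightarrow> real \<Rightarrow> real \<Rightarrow> real pmf" where
  "two_point_pmf lmin lmax a = map_pmf (\<lambda>b. if b then lmax else lmin) (bernoulli_pmf a)"

lemma pmf_two_point_pmf:
  assumes "lmin \<noteq> lmax" "0 \<le> a" "a \<le> 1"
  shows "pmf (two_point_pmf lmin lmax a) l =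
           (if l = lmax then a else if l = lmin then 1 - a else 0)"
proof -
  have inj: "inj (\<lambda>b. if b then lmax else lmin)"
    using assms(1) by (auto simp: inj_on_def split: if_splits)
  consider "l = lmax" | "l = lmin" | "l \<noteq> lmax" "l \<noteq> lmin" by blast
  then show ?thesis
  proof cases
    case 1
    then show ?thesis
      using pmf_map_inj'[OF inj, of "bernoulli_pmf a" True] assms by (simp add: two_point_pmf_def)
  next
    case 2
    then show ?thesis
      using pmf_map_inj'[OF inj, of "bernoulli_pmf a" False] assms by (simp add: two_point_pmf_def)
  next
    case 3
    then show ?thesis
      by (auto simp: two_point_pmf_def pmf_eq_0_set_pmf)
  qed
qed

lemma set_two_point_pmf: "lmin \<le> lmax \<Longrightarrow> set_pmf (two_point_pmf lmin lmax a) \<subseteq> {lmin..lmax}"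
  by (auto simp: two_point_pmf_def)

definition diff_cost_piece :: "nat \<Rightarrow> real \<Rightarrow> real \<Rightarrow> real \<Rightarrow> nat \<Rightarrow> real \<Rightarrow> real" where
  "diff_cost_piece n vbar lmin lmax i s =
     - ((real i + 1) * lmin + (real n - real i) * lmax) / (real n + 1) * s
     - real i * (real i + 1) * (lmax - lmin) * vbar / (2 * (real n + 1))"

text \<open>The cap \<open>n - 1\<close> on the piece index takes effect only at \<open>s = n * vbar\<close> within
  \<open>[0, n * vbar]\<close>.\<close>

definition diff_cost :: "nat \<Rightarrow> real \<Rightarrow> real \<Rightarrow> real \<Rightarrow> real \<Rightarrow> real" where
  "diff_cost n vbar lmin lmax s =
     diff_cost_piece n vbar lmin lmax (min (nat \<lfloor>s / vbar\<rfloor>) (n - 1)) s"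

lemma diff_cost_eq:
  assumes "vbar > 0" "i < n" "s \<in> {real i * vbar..<(real i + 1) * vbar}"
  shows "diff_cost n vbar lmin lmax s = diff_cost_piece n vbar lmin lmax i s"
proof -
  have "\<lfloor>s / vbar\<rfloor> = int i"
    using assms by (intro floor_unique) (auto simp: field_simps)
  moreover have "min i (n - 1) = i"
    using assms(2) by simp
  ultimately show ?thesis
    by (simp add: diff_cost_def)
qed

lemma diff_cost_top:
  assumes "vbar > 0"
  shows "diff_cost n vbar lmin lmax (real n * vbar) =
           diff_cost_piece n vbar lmin lmax (n - 1) (real n * vbar)"
proof -
  have "min n (n - 1) = n - 1"
    by simp
  then show ?thesis
    using assms by (simp add: diff_cost_def)
qed

end

theory Submission
  imports Defs
begin

text \<open>
  Write \<open>D = lmax - lmin\<close>, and let \<open>H\<close> be a bounded function on the state space. Along any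
  trajectory the accumulated cost plus \<open>H\<close> of the current state changes in one stage, in
  expectation, by the drift \<open>E[l * v + H (s + v)] - H s\<close>. A drift that is at least \<open>\<gamma>\<close> in every
  state therefore forces an average cost of at least \<open>\<gamma>\<close>, and a drift that equals \<open>\<gamma>\<close> everywhere
  gives average cost exactly \<open>\<gamma>\<close>. So everything reduces to finding a good \<open>H\<close> for prices of mean
  \<open>lmin + a * D\<close>.

  The store is cut into \<open>n\<close> layers of height \<open>vbar\<close>, and energy in layer \<open>j\<close> is given a marginal
  price \<open>lmin + D * p j\<close>. Two fictitious layers encode the boundary: below the empty store
  energy is worth \<open>lmax\<close> (\<open>p 0 = 1\<close>) and above the full store it is worth \<open>lmin\<close>
  (\<open>p (n + 1) = 0\<close>). Because all layer prices lie in \<open>[lmin, lmax]\<close>, at price \<open>lmax\<close> it is best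
  to sell \<open>vbar\<close> and at price \<open>lmin\<close> to buy \<open>vbar\<close>. Thanks to the fictitious layers a sale or
  purchase of the full \<open>vbar\<close> is worth just as much as the one that the capacity allows, so the
  capacity constraint disappears from the computation. Constancy of the
  drift then becomes the recursion \<open>a * (1 - p i) + (1 - a) * p (i + 1) = g\<close> for \<open>i = 0, ..., n\<close>,
  with drift \<open>- vbar * D * g\<close>. Its solution is a quotient of partial geometric sums with ratio
  \<open>b = (1 - a) / a\<close> (\<open>layer_prices_geometric\<close>).

  The stage cost is affine in the price, so a price between \<open>lmin\<close> and \<open>lmax\<close> is a mixture of the
  two endpoints for which the controller has to use the same control at both; this can only
  hurt. Hence any price distribution is worth at most as much as the two-point one with the same
  mean (\<open>storage_value_le\<close>, with equality in \<open>optimal_cost_two_point\<close>). The symmetric case is the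
  best of these because \<open>b ^ j + b ^ (n + 1 - j) \<le> 1 + b ^ (n + 1)\<close> (\<open>geometric_gain_le\<close>). For
  \<open>a = 1 / 2\<close> the prices \<open>p\<close> decrease linearly, and \<open>H\<close> is, up to a constant, the given
  differential cost; it is convex because it is the maximum of its affine pieces.
\<close>

section \<open>Expectations over independent prices\<close>

lemma integrable_measure_pmf_bounded:
  fixes f :: "'a \<Rightarrow> real"
  assumes "\<And>x. x \<in> set_pmf p \<Longrightarrow> \<bar>f x\<bar> \<le> B"
  shows "integrable (measure_pmf p) f"
  by (rule measure_pmf.integrable_const_bound[where B=B])
    (use assms in \<open>auto simp: AE_measure_pmf_iff\<close>)

lemma expectation_cong_pmf:
  fixes f g :: "'a \<Rightarrow> real"
  assumes "\<And>x. x \<in> set_pmf p \<Longrightarrow> f x = g x"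
  shows "measure_pmf.expectation p f = measure_pmf.expectation p g"
  by (intro integral_cong_AE) (use assms in \<open>auto simp: AE_measure_pmf_iff\<close>)

text \<open>Truncating \<open>f\<close> outside the support makes it bounded everywhere, as the disintegration
  theorem for kernels demands; the expectations only see the support.\<close>

lemma expectation_bind_pmf_bounded:
  fixes f :: "'b \<Rightarrow> real"
  assumes bd: "\<And>x. x \<in> set_pmf (bind_pmf p q) \<Longrightarrow> \<bar>f x\<bar> \<le> B"
  shows "measure_pmf.expectation (bind_pmf p q) f
       = measure_pmf.expectation p (\<lambda>x. measure_pmf.expectation (q x) f)"
proof -
  define g where "g = (\<lambda>x. if x \<in> set_pmf (bind_pmf p q) then f x else 0)"
  have "\<bar>g x\<bar> \<le> max 0 B" for x
    using bd[of x] by (cases "x \<in> set_pmf (bind_pmf p q)") (simp_all add: g_def del: set_bind_pmf)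
  then have "measure_pmf.expectation (bind_pmf p q) g
      = measure_pmf.expectation p (\<lambda>x. measure_pmf.expectation (q x) g)"
    unfolding measure_pmf_bind
    by (intro integral_bind[where K="count_space UNIV" and B'=1])
      (auto simp: measure_pmf.emeasure_space_1 space_subprob_algebra subprob_space_measure_pmf
        intro: measure_pmf.finite_measure_axioms)
  moreover have "measure_pmf.expectation (bind_pmf p q) g = measure_pmf.expectation (bind_pmf p q) f"
    by (intro expectation_cong_pmf) (auto simp: g_def)
  moreover have "measure_pmf.expectation p (\<lambda>x. measure_pmf.expectation (q x) g)
      = measure_pmf.expectation p (\<lambda>x. measure_pmf.expectation (q x) f)"
    by (intro expectation_cong_pmf) (auto simp: g_def)
  ultimately show ?thesis by simp
qed

text \<open>The newest price is independent of the earlier ones, so it can be averaged first, with the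
  history held fixed.\<close>

lemma expectation_Pi_pmf_Suc:
  fixes f :: "(nat \<Rightarrow> 'a) \<Rightarrow> real"
  assumes bd: "\<And>w. w \<in> set_pmf (Pi_pmf {..<Suc N} d P) \<Longrightarrow> \<bar>f w\<bar> \<le> B"
  shows "measure_pmf.expectation (Pi_pmf {..<Suc N} d P) f
       = measure_pmf.expectation (Pi_pmf {..<N} d P)
           (\<lambda>w. measure_pmf.expectation (P N) (\<lambda>l. f (w(N := l))))"
proof -
  have eq: "Pi_pmf {..<Suc N} d P
      = bind_pmf (Pi_pmf {..<N} d P) (\<lambda>w. map_pmf (\<lambda>l. w(N := l)) (P N))"
    unfolding lessThan_Suc
    by (simp add: Pi_pmf_insert' map_pmf_def) (rule bind_commute_pmf)
  show ?thesis
    unfolding eq by (subst expectation_bind_pmf_bounded) (use bd in \<open>auto simp: eq\<close>)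
qed

section \<open>Average cost and drift\<close>

definition drift ::
  "real pmf \<Rightarrow> (real \<Rightarrow> real) \<Rightarrow> (real \<Rightarrow> real \<Rightarrow> real) \<Rightarrow> real \<Rightarrow> real" where
  "drift P H \<pi> s = measure_pmf.expectation P (\<lambda>l. l * \<pi> s l + H (s + \<pi> s l)) - H s"

text \<open>The accumulated cost corrected by the potential of the state that has been reached. For
  bounded \<open>H\<close> the correction is invisible in the average over a long horizon.\<close>

definition total_cost ::
  "(real \<Rightarrow> real) \<Rightarrow> (real \<Rightarrow> real \<Rightarrow> real) \<Rightarrow> real \<Rightarrow> nat \<Rightarrow> (nat \<Rightarrow> real) \<Rightarrow> real" where
  "total_cost H \<pi> s N w =
     (\<Sum>k<N. w k * \<pi> (storage_state \<pi> s w k) (w k)) + H (storage_state \<pi> s w N)"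

lemma storage_state_cong:
  "(\<And>k. k < N \<Longrightarrow> w k = w' k) \<Longrightarrow> storage_state \<pi> s w N = storage_state \<pi> s w' N"
  by (induction N) auto

lemma total_cost_Suc:
  "total_cost H \<pi> s (Suc N) (w(N := l))
     = total_cost H \<pi> s N w - H (storage_state \<pi> s w N)
       + (l * \<pi> (storage_state \<pi> s w N) l + H (storage_state \<pi> s w N + \<pi> (storage_state \<pi> s w N) l))"
proof -
  have st: "storage_state \<pi> s (w(N := l)) k = storage_state \<pi> s w k" if "k \<le> N" for k
    using that by (intro storage_state_cong) auto
  have "(\<Sum>k<N. (w(N := l)) k * \<pi> (storage_state \<pi> s (w(N := l)) k) ((w(N := l)) k))
      = (\<Sum>k<N. w k * \<pi> (storage_state \<pi> s w k) (w k))"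
    by (intro sum.cong) (auto simp: st)
  then show ?thesis
    using st[of N] by (simp add: total_cost_def)
qed

context
  fixes vbar sbar lmin lmax s0 B :: real and P :: "real pmf"
    and \<pi> :: "real \<Rightarrow> real \<Rightarrow> real" and H :: "real \<Rightarrow> real"
  assumes vbar: "0 \<le> vbar" and lmin: "0 \<le> lmin" and P: "set_pmf P \<subseteq> {lmin..lmax}"
    and s0: "s0 \<in> {0..sbar}" and feas: "feasible_policy vbar sbar \<pi>"
    and bdd: "\<And>s. s \<in> {0..sbar} \<Longrightarrow> \<bar>H s\<bar> \<le> B"
begin

lemma price_in_support:
  "w \<in> set_pmf (Pi_pmf {..<N} 0 (\<lambda>_. P)) \<Longrightarrow> k < (N::nat) \<Longrightarrow> w k \<in> {lmin..lmax}"
  using P set_Pi_pmf_subset'[OF finite_lessThan[of N], of 0 "\<lambda>_. P"]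
  by (fastforce simp: PiE_dflt_def)

lemma storage_state_mem:
  assumes "w \<in> set_pmf (Pi_pmf {..<N} 0 (\<lambda>_. P))" "k \<le> N"
  shows "storage_state \<pi> s0 w k \<in> {0..sbar}"
  using assms(2)
proof (induction k)
  case (Suc k)
  have "w k \<ge> 0"
    using price_in_support[OF assms(1), of k] Suc.prems lmin by auto
  then show ?case
    using Suc feas by (auto simp: feasible_policy_def)
qed (use s0 in auto)

lemma stage_cost_bound:
  assumes "s \<in> {0..sbar}" "l \<in> {lmin..lmax}"
  shows "\<bar>l * \<pi> s l\<bar> \<le> lmax * vbar"
proof -
  have "\<pi> s l \<in> {- vbar..vbar}"
    using assms feas lmin by (auto simp: feasible_policy_def)
  then have "\<bar>\<pi> s l\<bar> \<le> vbar" by auto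
  then show ?thesis
    using assms lmin by (auto simp: abs_mult intro!: mult_mono)
qed

lemma next_state_mem:
  "s \<in> {0..sbar} \<Longrightarrow> l \<in> {lmin..lmax} \<Longrightarrow> s + \<pi> s l \<in> {0..sbar}"
  using feas lmin by (auto simp: feasible_policy_def)

lemma total_cost_bound:
  assumes "w \<in> set_pmf (Pi_pmf {..<N} 0 (\<lambda>_. P))"
  shows "\<bar>total_cost H \<pi> s0 N w\<bar> \<le> real N * (lmax * vbar) + B"
proof -
  have "\<bar>\<Sum>k<N. w k * \<pi> (storage_state \<pi> s0 w k) (w k)\<bar> \<le> (\<Sum>k<N. lmax * vbar)"
    by (rule order_trans[OF sum_abs], rule sum_mono, rule stage_cost_bound)
      (use storage_state_mem[OF assms] price_in_support[OF assms] in \<open>auto simp del: atLeastAtMost_iff\<close>)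
  moreover have "\<bar>H (storage_state \<pi> s0 w N)\<bar> \<le> B"
    using storage_state_mem[OF assms] bdd by blast
  ultimately show ?thesis
    by (auto simp: total_cost_def)
qed

lemma integrable_stage:
  assumes "s \<in> {0..sbar}"
  shows "integrable (measure_pmf P) (\<lambda>l. l * \<pi> s l + H (s + \<pi> s l))"
proof (rule integrable_measure_pmf_bounded)
  fix l assume "l \<in> set_pmf P"
  with P have l: "l \<in> {lmin..lmax}" by auto
  show "\<bar>l * \<pi> s l + H (s + \<pi> s l)\<bar> \<le> lmax * vbar + B"
    using stage_cost_bound[OF assms l] bdd[OF next_state_mem[OF assms l]] by linarith
qed

lemma drift_bound:
  assumes "s \<in> {0..sbar}"
  shows "\<bar>drift P H \<pi> s\<bar> \<le> lmax * vbar + 2 * B"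
proof -
  have "\<bar>measure_pmf.expectation P (\<lambda>l. l * \<pi> s l + H (s + \<pi> s l))\<bar>
      \<le> measure_pmf.expectation P (\<lambda>l. \<bar>l * \<pi> s l + H (s + \<pi> s l)\<bar>)"
    by (rule integral_abs_bound)
  also have "\<dots> \<le> lmax * vbar + B"
  proof (intro measure_pmf.integral_le_const integrable_abs integrable_stage[OF assms])
    show "AE l in measure_pmf P. \<bar>l * \<pi> s l + H (s + \<pi> s l)\<bar> \<le> lmax * vbar + B"
      unfolding AE_measure_pmf_iff
    proof
      fix l assume "l \<in> set_pmf P"
      with P have l: "l \<in> {lmin..lmax}" by auto
      show "\<bar>l * \<pi> s l + H (s + \<pi> s l)\<bar> \<le> lmax * vbar + B"
        using stage_cost_bound[OF assms l] bdd[OF next_state_mem[OF assms l]] by linarith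
    qed
  qed
  finally show ?thesis
    using bdd[OF assms] by (simp add: drift_def)
qed

lemma integrable_drift:
  "integrable (measure_pmf (Pi_pmf {..<N} 0 (\<lambda>_. P))) (\<lambda>w. drift P H \<pi> (storage_state \<pi> s0 w N))"
  by (rule integrable_measure_pmf_bounded, rule drift_bound, erule storage_state_mem) simp

text \<open>The martingale-like identity behind the verification argument: given the history, the
  expected increment of the total cost is the drift at the current state.\<close>

lemma expected_total_cost_Suc:
  "measure_pmf.expectation (Pi_pmf {..<Suc N} 0 (\<lambda>_. P)) (total_cost H \<pi> s0 (Suc N))
     = measure_pmf.expectation (Pi_pmf {..<N} 0 (\<lambda>_. P)) (total_cost H \<pi> s0 N)
       + measure_pmf.expectation (Pi_pmf {..<N} 0 (\<lambda>_. P))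
           (\<lambda>w. drift P H \<pi> (storage_state \<pi> s0 w N))"
proof -
  let ?M = "Pi_pmf {..<N} 0 (\<lambda>_. P)"
  have "measure_pmf.expectation (Pi_pmf {..<Suc N} 0 (\<lambda>_. P)) (total_cost H \<pi> s0 (Suc N))
      = measure_pmf.expectation ?M
          (\<lambda>w. measure_pmf.expectation P (\<lambda>l. total_cost H \<pi> s0 (Suc N) (w(N := l))))"
    by (rule expectation_Pi_pmf_Suc, erule total_cost_bound)
  also have "\<dots> = measure_pmf.expectation ?M
      (\<lambda>w. total_cost H \<pi> s0 N w + drift P H \<pi> (storage_state \<pi> s0 w N))"
  proof (rule expectation_cong_pmf)
    fix w assume "w \<in> set_pmf ?M"
    then have "storage_state \<pi> s0 w N \<in> {0..sbar}"
      by (rule storage_state_mem) simp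
    from integrable_stage[OF this]
    show "measure_pmf.expectation P (\<lambda>l. total_cost H \<pi> s0 (Suc N) (w(N := l)))
        = total_cost H \<pi> s0 N w + drift P H \<pi> (storage_state \<pi> s0 w N)"
      unfolding total_cost_Suc drift_def by (subst Bochner_Integration.integral_add) auto
  qed
  also have "\<dots> = measure_pmf.expectation ?M (total_cost H \<pi> s0 N)
      + measure_pmf.expectation ?M (\<lambda>w. drift P H \<pi> (storage_state \<pi> s0 w N))"
    by (intro Bochner_Integration.integral_add integrable_drift
        integrable_measure_pmf_bounded[OF total_cost_bound])
  finally show ?thesis .
qed

lemma expected_total_cost_lower:
  assumes "\<And>s. s \<in> {0..sbar} \<Longrightarrow> \<gamma> \<le> drift P H \<pi> s"
  shows "H s0 + real N * \<gamma>
    \<le> measure_pmf.expectation (Pi_pmf {..<N} 0 (\<lambda>_. P)) (total_cost H \<pi> s0 N)"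
proof (induction N)
  case (Suc N)
  have "\<gamma> \<le> measure_pmf.expectation (Pi_pmf {..<N} 0 (\<lambda>_. P))
      (\<lambda>w. drift P H \<pi> (storage_state \<pi> s0 w N))"
    by (intro measure_pmf.integral_ge_const integrable_drift)
      (auto simp: AE_measure_pmf_iff simp del: atLeastAtMost_iff intro!: assms storage_state_mem)
  then show ?case
    using Suc by (simp add: expected_total_cost_Suc algebra_simps)
qed (simp add: total_cost_def)

lemma expected_total_cost_eq:
  assumes "\<And>s. s \<in> {0..sbar} \<Longrightarrow> drift P H \<pi> s = \<gamma>"
  shows "measure_pmf.expectation (Pi_pmf {..<N} 0 (\<lambda>_. P)) (total_cost H \<pi> s0 N)
    = H s0 + real N * \<gamma>"
proof (induction N)
  case (Suc N)
  have "measure_pmf.expectation (Pi_pmf {..<N} 0 (\<lambda>_. P))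
      (\<lambda>w. drift P H \<pi> (storage_state \<pi> s0 w N))
      = measure_pmf.expectation (Pi_pmf {..<N} 0 (\<lambda>_. P)) (\<lambda>w. \<gamma>)"
    by (rule expectation_cong_pmf, rule assms, erule storage_state_mem) simp
  then show ?case
    using Suc by (simp add: expected_total_cost_Suc algebra_simps)
qed (simp add: total_cost_def)

lemma expected_cost_near_total:
  "\<bar>expected_cost (\<lambda>_. P) \<pi> s0 N
     - measure_pmf.expectation (Pi_pmf {..<N} 0 (\<lambda>_. P)) (total_cost H \<pi> s0 N)\<bar> \<le> B"
proof -
  let ?M = "Pi_pmf {..<N} 0 (\<lambda>_. P)"
  have Hb: "\<bar>H (storage_state \<pi> s0 w N)\<bar> \<le> B" if "w \<in> set_pmf ?M" for w
    using bdd storage_state_mem[OF that] by blast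
  have int: "integrable (measure_pmf ?M) (\<lambda>w. H (storage_state \<pi> s0 w N))"
    by (rule integrable_measure_pmf_bounded[OF Hb])
  have "expected_cost (\<lambda>_. P) \<pi> s0 N
      = measure_pmf.expectation ?M (\<lambda>w. total_cost H \<pi> s0 N w - H (storage_state \<pi> s0 w N))"
    by (simp add: expected_cost_def total_cost_def)
  also have "\<dots> = measure_pmf.expectation ?M (total_cost H \<pi> s0 N)
      - measure_pmf.expectation ?M (\<lambda>w. H (storage_state \<pi> s0 w N))"
    by (intro Bochner_Integration.integral_diff int
        integrable_measure_pmf_bounded[OF total_cost_bound])
  moreover have "\<bar>measure_pmf.expectation ?M (\<lambda>w. H (storage_state \<pi> s0 w N))\<bar>
      \<le> measure_pmf.expectation ?M (\<lambda>w. \<bar>H (storage_state \<pi> s0 w N)\<bar>)"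
    by (rule integral_abs_bound)
  moreover have "\<dots> \<le> B"
    by (intro measure_pmf.integral_le_const integrable_abs int)
      (use Hb in \<open>auto simp: AE_measure_pmf_iff\<close>)
  ultimately show ?thesis by linarith
qed

lemma average_cost_ge_drift:
  assumes "\<And>s. s \<in> {0..sbar} \<Longrightarrow> \<gamma> \<le> drift P H \<pi> s"
    and "has_average_cost (\<lambda>_. P) \<pi> s0 c"
  shows "\<gamma> \<le> c"
proof (rule LIMSEQ_le)
  show "(\<lambda>N. 1 / real N * expected_cost (\<lambda>_. P) \<pi> s0 N) \<longlonglongrightarrow> c"
    using assms(2) by (simp add: has_average_cost_def)
  have "(\<lambda>N. \<gamma> + (H s0 - B) / real N) \<longlonglongrightarrow> \<gamma> + 0"
    by (intro tendsto_add tendsto_const lim_const_over_n)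
  then show "(\<lambda>N. \<gamma> + (H s0 - B) / real N) \<longlonglongrightarrow> \<gamma>" by simp
  have "\<gamma> + (H s0 - B) / real N \<le> 1 / real N * expected_cost (\<lambda>_. P) \<pi> s0 N" if "N \<ge> 1" for N
  proof -
    have "real N * \<gamma> + (H s0 - B) \<le> expected_cost (\<lambda>_. P) \<pi> s0 N"
      using expected_total_cost_lower[OF assms(1), of N] expected_cost_near_total[of N] by linarith
    from divide_right_mono[OF this, of "real N"] that show ?thesis
      by (simp add: add_divide_distrib)
  qed
  then show "\<exists>N. \<forall>n\<ge>N. \<gamma> + (H s0 - B) / real n \<le> 1 / real n * expected_cost (\<lambda>_. P) \<pi> s0 n"
    by blast
qed

lemma average_cost_eq_drift:
  assumes "\<And>s. s \<in> {0..sbar} \<Longrightarrow> drift P H \<pi> s = \<gamma>"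
  shows "has_average_cost (\<lambda>_. P) \<pi> s0 \<gamma>"
  unfolding has_average_cost_def
proof (rule LIMSEQ_I)
  fix r :: real assume "0 < r"
  have lim: "(\<lambda>N. (\<bar>H s0\<bar> + B) / real N) \<longlonglongrightarrow> 0"
    by (rule lim_const_over_n)
  from LIMSEQ_D[OF lim \<open>0 < r\<close>] obtain N0
    where N0: "\<And>N. N \<ge> N0 \<Longrightarrow> \<bar>(\<bar>H s0\<bar> + B) / real N\<bar> < r" by auto
  have "norm (1 / real N * expected_cost (\<lambda>_. P) \<pi> s0 N - \<gamma>) < r" if "N \<ge> max 1 N0" for N
  proof -
    have "\<bar>expected_cost (\<lambda>_. P) \<pi> s0 N - real N * \<gamma>\<bar> \<le> \<bar>H s0\<bar> + B"
      using expected_total_cost_eq[OF assms, of N] expected_cost_near_total[of N] by linarith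
    moreover have "1 / real N * expected_cost (\<lambda>_. P) \<pi> s0 N - \<gamma>
        = (expected_cost (\<lambda>_. P) \<pi> s0 N - real N * \<gamma>) / real N"
      using that by (simp add: field_simps)
    ultimately have "\<bar>1 / real N * expected_cost (\<lambda>_. P) \<pi> s0 N - \<gamma>\<bar> \<le> (\<bar>H s0\<bar> + B) / real N"
      by (simp add: divide_right_mono)
    also have "\<dots> < r"
      using N0[of N] that by (meson abs_ge_self le_less_trans max.boundedE)
    finally show ?thesis by simp
  qed
  then show "\<exists>N0. \<forall>N\<ge>N0. norm (1 / real N * expected_cost (\<lambda>_. P) \<pi> s0 N - \<gamma>) < r"
    by blast
qed

end

section \<open>Layered storage and its marginal prices\<close>

text \<open>The energy between the levels \<open>j * vbar\<close> and \<open>(j + 1) * vbar\<close> in a store filled up to \<open>x\<close>.\<close>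

definition layer_fill :: "real \<Rightarrow> nat \<Rightarrow> real \<Rightarrow> real" where
  "layer_fill vbar j x = max 0 (min vbar (x - real j * vbar))"

lemma sum_layer_fill:
  assumes "0 \<le> vbar"
  shows "(\<Sum>j<m. layer_fill vbar j x) = max 0 (min x (real m * vbar))"
proof (induction m)
  case (Suc m)
  define M where "M = real m * vbar"
  have M: "0 \<le> M" "real (Suc m) * vbar = M + vbar"
    using assms by (simp_all add: M_def algebra_simps)
  have top: "layer_fill vbar m x = max 0 (min vbar (x - M))"
    by (simp add: layer_fill_def M_def)
  show ?case
    unfolding sum.lessThan_Suc Suc.IH[folded M_def] M(2) top
    using M(1) assms by (simp add: max_def min_def)
qed simp

lemma layer_fill_full: "0 \<le> vbar \<Longrightarrow> real j * vbar + vbar \<le> x \<Longrightarrow> layer_fill vbar j x = vbar"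
  by (simp add: layer_fill_def)

lemma layer_fill_empty: "x \<le> real j * vbar \<Longrightarrow> layer_fill vbar j x = 0"
  by (simp add: layer_fill_def max_def min_def)

text \<open>The value of the stored energy when layer \<open>j\<close> is priced \<open>p j\<close>. The level is shifted by
  \<open>vbar\<close> so that layer 0 is the fictitious one below the empty store (full whenever \<open>0 \<le> x\<close>), and
  layers \<open>1, ..., n\<close> are the physical ones.\<close>

definition layered_value :: "real \<Rightarrow> nat \<Rightarrow> (nat \<Rightarrow> real) \<Rightarrow> real \<Rightarrow> real" where
  "layered_value vbar n p x = (\<Sum>j\<le>n. p j * layer_fill vbar j (x + vbar))"

text \<open>Layer prices for which the drift does not depend on the state, for prices normalised to 0 and
  1 with mean \<open>a\<close>; \<open>g\<close> is the gain per stage and per unit of \<open>vbar\<close>.\<close>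

definition layer_prices :: "nat \<Rightarrow> real \<Rightarrow> real \<Rightarrow> (nat \<Rightarrow> real) \<Rightarrow> bool" where
  "layer_prices n a g p \<longleftrightarrow>
     0 \<le> a \<and> a \<le> 1 \<and> p 0 = 1 \<and> p (Suc n) = 0 \<and> (\<forall>i\<le>n. 0 \<le> p i \<and> p i \<le> 1) \<and>
     (\<forall>i\<le>n. a * (1 - p i) + (1 - a) * p (Suc i) = g)"

definition potential ::
  "real \<Rightarrow> nat \<Rightarrow> real \<Rightarrow> real \<Rightarrow> (nat \<Rightarrow> real) \<Rightarrow> real \<Rightarrow> real" where
  "potential vbar n lmin lmax p s = - lmin * s - (lmax - lmin) * layered_value vbar n p s"

text \<open>The lower bound 0 on purchases matters only for \<open>sbar < s\<close>, where a policy still has to respect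
  \<open>[-vbar, vbar]\<close>.\<close>

definition bang_bang :: "real \<Rightarrow> real \<Rightarrow> real \<Rightarrow> real \<Rightarrow> real \<Rightarrow> real" where
  "bang_bang vbar sbar lmax s l = (if l = lmax then - min s vbar else max 0 (min vbar (sbar - s)))"

context
  fixes vbar a g :: real and n :: nat and p :: "nat \<Rightarrow> real"
  assumes vbar: "0 < vbar" and p: "layer_prices n a g p"
begin

text \<open>All layer prices lie between 0 and 1, so one more unit of energy is worth between 0 and 1
  wherever it is put. This makes extreme controls optimal at extreme prices.\<close>

lemma layered_value_increment:
  assumes "x \<le> y"
  shows "layered_value vbar n p x \<le> layered_value vbar n p y"
    and "layered_value vbar n p y - layered_value vbar n p x \<le> y - x"
proof -
  have d: "layer_fill vbar j (x + vbar) \<le> layer_fill vbar j (y + vbar)" for j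
    using assms by (auto simp: layer_fill_def)
  show "layered_value vbar n p x \<le> layered_value vbar n p y"
    unfolding layered_value_def
    by (intro sum_mono mult_left_mono d) (use p in \<open>auto simp: layer_prices_def\<close>)
  have "layered_value vbar n p y - layered_value vbar n p x
      = (\<Sum>j\<le>n. p j * (layer_fill vbar j (y + vbar) - layer_fill vbar j (x + vbar)))"
    by (simp add: layered_value_def sum_subtractf algebra_simps)
  also have "\<dots> \<le> (\<Sum>j\<le>n. layer_fill vbar j (y + vbar) - layer_fill vbar j (x + vbar))"
    by (intro sum_mono mult_left_le_one_le) (use p d in \<open>auto simp: layer_prices_def\<close>)
  also have "\<dots> \<le> y - x"
    using sum_layer_fill[of vbar "x + vbar" "Suc n"] sum_layer_fill[of vbar "y + vbar" "Suc n"]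
      vbar assms
    by (simp add: sum_subtractf lessThan_Suc_atMost max_def min_def)
  finally show "layered_value vbar n p y - layered_value vbar n p x \<le> y - x" .
qed

text \<open>A full purchase or sale shifts the contents of all layers by one layer, so both the sale and the
  purchase are sums over the same fillings with the price index shifted by one. Eliminating \<open>p j\<close>
  in favour of \<open>p (Suc j)\<close> by the recursion leaves only the total filling \<open>s + vbar\<close>, which
  is known.\<close>

lemma layered_value_balance:
  assumes "0 \<le> s" "s \<le> real n * vbar"
  shows "a * (vbar + layered_value vbar n p (s - vbar)) + (1 - a) * layered_value vbar n p (s + vbar)
       = layered_value vbar n p s + g * vbar"
proof -
  define f where "f j = layer_fill vbar j (s + vbar)" for j
  have f0: "f 0 = vbar" and fn: "f (Suc n) = 0"
    using assms vbar by (auto simp: f_def layer_fill_def algebra_simps)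
  have p0: "p 0 = 1" and pn: "p (Suc n) = 0"
    and rec: "\<And>i. i \<le> n \<Longrightarrow> a * p i = a - g + (1 - a) * p (Suc i)"
    using p by (auto simp: layer_prices_def algebra_simps)
  have total: "(\<Sum>j\<le>n. f j) = s + vbar"
    using sum_layer_fill[of vbar "s + vbar" "Suc n"] vbar assms
    by (simp add: f_def lessThan_Suc_atMost algebra_simps)
  have total': "(\<Sum>j\<le>n. f (Suc j)) = s"
    using total fn f0 sum.atMost_Suc_shift[of f n] by simp
  have V: "layered_value vbar n p s = (\<Sum>j\<le>n. p j * f j)"
    by (simp add: layered_value_def f_def)
  have shift: "(\<Sum>j\<le>n. p (Suc j) * f (Suc j)) = layered_value vbar n p s - vbar"
    using sum.atMost_Suc_shift[of "\<lambda>j. p j * f j" n] by (simp add: V p0 f0 fn)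
  have down: "layered_value vbar n p (s - vbar) = (\<Sum>j\<le>n. p j * f (Suc j))"
    unfolding layered_value_def f_def by (intro sum.cong) (auto simp: layer_fill_def algebra_simps)
  \<comment> \<open>the fictitious top layer enters with price 0, which makes room for the shifted index\<close>
  have up: "layered_value vbar n p (s + vbar) = vbar + (\<Sum>j\<le>n. p (Suc j) * f j)"
  proof -
    have "layered_value vbar n p (s + vbar)
        = (\<Sum>j\<le>Suc n. p j * layer_fill vbar j (s + vbar + vbar))"
      by (simp add: layered_value_def pn)
    also have "\<dots> = vbar + (\<Sum>j\<le>n. p (Suc j) * layer_fill vbar (Suc j) (s + vbar + vbar))"
      using assms vbar by (subst sum.atMost_Suc_shift) (simp add: p0 layer_fill_def)
    also have "(\<Sum>j\<le>n. p (Suc j) * layer_fill vbar (Suc j) (s + vbar + vbar))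
        = (\<Sum>j\<le>n. p (Suc j) * f j)"
      unfolding f_def by (intro sum.cong) (auto simp: layer_fill_def algebra_simps)
    finally show ?thesis .
  qed
  have "a * (\<Sum>j\<le>n. p j * f (Suc j)) = (\<Sum>j\<le>n. (a - g + (1 - a) * p (Suc j)) * f (Suc j))"
    unfolding sum_distrib_left by (intro sum.cong) (auto simp: rec[symmetric])
  also have "\<dots> = (a - g) * (\<Sum>j\<le>n. f (Suc j)) + (1 - a) * (\<Sum>j\<le>n. p (Suc j) * f (Suc j))"
    by (simp add: sum.distrib sum_distrib_left distrib_right mult.assoc)
  finally have 1: "a * (\<Sum>j\<le>n. p j * f (Suc j))
      = (a - g) * s + (1 - a) * (layered_value vbar n p s - vbar)"
    unfolding total' shift .
  have "a * layered_value vbar n p s = (\<Sum>j\<le>n. (a - g + (1 - a) * p (Suc j)) * f j)"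
    unfolding V sum_distrib_left by (intro sum.cong) (auto simp: rec[symmetric])
  also have "\<dots> = (a - g) * (\<Sum>j\<le>n. f j) + (1 - a) * (\<Sum>j\<le>n. p (Suc j) * f j)"
    by (simp add: sum.distrib sum_distrib_left distrib_right mult.assoc)
  finally have 2: "(1 - a) * (\<Sum>j\<le>n. p (Suc j) * f j)
      = a * layered_value vbar n p s - (a - g) * (s + vbar)"
    unfolding total by simp
  show ?thesis
    unfolding up down using 1 2 by (simp add: algebra_simps)
qed

lemma layered_value_piece:
  assumes "i < n" "s \<in> {real i * vbar..(real i + 1) * vbar}"
  shows "layered_value vbar n p s = vbar * (\<Sum>j\<le>i. p j) + p (Suc i) * (s - real i * vbar)"
proof -
  have "layered_value vbar n p s = (\<Sum>j\<le>Suc i. p j * layer_fill vbar j (s + vbar))"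
    unfolding layered_value_def
  proof (rule sum.mono_neutral_right)
    show "\<forall>j\<in>{..n} - {..Suc i}. p j * layer_fill vbar j (s + vbar) = 0"
    proof
      fix j assume "j \<in> {..n} - {..Suc i}"
      then have "(real i + 2) * vbar \<le> real j * vbar"
        using vbar by (intro mult_right_mono) auto
      with assms show "p j * layer_fill vbar j (s + vbar) = 0"
        by (subst layer_fill_empty) (auto simp: algebra_simps)
    qed
  qed (use assms in auto)
  also have "\<dots> = (\<Sum>j\<le>i. p j * layer_fill vbar j (s + vbar))
      + p (Suc i) * layer_fill vbar (Suc i) (s + vbar)" by simp
  also have "layer_fill vbar (Suc i) (s + vbar) = s - real i * vbar"
    using assms by (auto simp: layer_fill_def algebra_simps)
  also have "(\<Sum>j\<le>i. p j * layer_fill vbar j (s + vbar)) = (\<Sum>j\<le>i. p j * vbar)"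
  proof (rule sum.cong)
    fix j assume "j \<in> {..i}"
    then have "real j * vbar \<le> real i * vbar"
      using vbar by (intro mult_right_mono) auto
    then have "real j * vbar + vbar \<le> s + vbar"
      using assms(2) unfolding atLeastAtMost_iff by linarith
    then show "p j * layer_fill vbar j (s + vbar) = p j * vbar"
      using vbar by (simp add: layer_fill_full)
  qed simp
  finally show ?thesis
    by (simp add: sum_distrib_left mult.commute)
qed

text \<open>What cannot be delivered from a store holding less than \<open>vbar\<close> comes out of the fictitious
  layer 0, whose price 1 exactly offsets the revenue.\<close>

lemma layered_value_sell:
  assumes "0 \<le> s"
  shows "vbar + layered_value vbar n p (s - vbar)
       = min s vbar + layered_value vbar n p (s - min s vbar)"
proof (cases "vbar \<le> s")
  case False
  have *: "layered_value vbar n p x = x + vbar" if "- vbar \<le> x" "x \<le> 0" for x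
  proof -
    have "layered_value vbar n p x = (\<Sum>j\<le>n. if j = 0 then x + vbar else 0)"
      unfolding layered_value_def
    proof (rule sum.cong)
      fix j
      show "p j * layer_fill vbar j (x + vbar) = (if j = 0 then x + vbar else 0)"
      proof (cases j)
        case 0
        then show ?thesis
          using that p by (simp add: layer_fill_def layer_prices_def)
      next
        case (Suc k)
        have "0 \<le> real k * vbar" using vbar by simp
        then have "x + vbar \<le> real k * vbar + vbar"
          using that by linarith
        also have "\<dots> = real j * vbar"
          by (simp add: Suc algebra_simps)
        finally show ?thesis
          using Suc by (simp add: layer_fill_empty)
      qed
    qed simp
    then show ?thesis by simp
  qed
  show ?thesis
    using False assms by (simp add: * min_def)
qed (simp add: min_def)

text \<open>Energy bought beyond the capacity falls into the fictitious top layer, which is worth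
  nothing.\<close>

lemma layered_value_buy:
  "layered_value vbar n p (s + vbar) = layered_value vbar n p (s + min vbar (real n * vbar - s))"
proof (cases "vbar \<le> real n * vbar - s")
  case False
  have *: "layered_value vbar n p x = (\<Sum>j\<le>n. p j * vbar)" if "real n * vbar \<le> x" for x
    unfolding layered_value_def
  proof (rule sum.cong)
    fix j assume "j \<in> {..n}"
    then have "real j * vbar \<le> real n * vbar"
      using vbar by (intro mult_right_mono) auto
    then have "real j * vbar + vbar \<le> x + vbar"
      using that by linarith
    then show "p j * layer_fill vbar j (x + vbar) = p j * vbar"
      using vbar by (simp add: layer_fill_full)
  qed simp
  show ?thesis
    using False by (simp add: * min_def)
qed (simp add: min_def)

lemma layered_value_bounds:
  assumes "0 \<le> s"
  shows "0 \<le> layered_value vbar n p s" "layered_value vbar n p s \<le> s + vbar"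
proof -
  have "layered_value vbar n p 0 = vbar + layered_value vbar n p (- vbar)"
    using layered_value_sell[of 0] vbar by simp
  moreover have "layered_value vbar n p (- vbar) = 0"
    using vbar by (simp add: layered_value_def layer_fill_empty)
  ultimately show "0 \<le> layered_value vbar n p s" "layered_value vbar n p s \<le> s + vbar"
    using layered_value_increment[of 0 s] assms vbar by auto
qed

section \<open>Optimal control for the layered potential\<close>

context
  fixes lmin lmax sbar :: real
  assumes lmin: "0 \<le> lmin" and le: "lmin \<le> lmax" and sbar: "sbar = real n * vbar"
begin

lemma potential_bounded:
  assumes "s \<in> {0..sbar}"
  shows "\<bar>potential vbar n lmin lmax p s\<bar> \<le> lmin * sbar + (lmax - lmin) * (sbar + vbar)"
proof -
  have "0 \<le> lmin * s" "lmin * s \<le> lmin * sbar"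
    using assms lmin by (auto intro: mult_left_mono)
  moreover have "0 \<le> (lmax - lmin) * layered_value vbar n p s"
    using assms le layered_value_bounds[of s] by simp
  moreover have "(lmax - lmin) * layered_value vbar n p s \<le> (lmax - lmin) * (sbar + vbar)"
    using assms le layered_value_bounds[of s] by (intro mult_left_mono) auto
  ultimately show ?thesis
    by (simp add: potential_def)
qed

text \<open>With \<open>l - lmin\<close> and \<open>lmax - l\<close> as weights, the stage cost is a nonnegative combination of
  the costs at normalised prices 1 and 0. The weights are not normalised, so that the identity also
  covers a degenerate price interval.\<close>

lemma stage_decomposition:
  "l * v + potential vbar n lmin lmax p (s + v) = - lmin * s
     - (l - lmin) * (layered_value vbar n p (s + v) - v)
     - (lmax - l) * layered_value vbar n p (s + v)"
  by (simp add: potential_def algebra_simps)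

text \<open>The two summands of the decomposition are bounded separately, the first by a full sale and
  the second by a full purchase. For intermediate \<open>l\<close> this is generally not attained, which is how
  interior prices lower the value of storage.\<close>

lemma stage_lower_bound:
  assumes "l \<in> {lmin..lmax}" "v \<in> {- vbar..vbar}"
  shows "- lmin * s - (l - lmin) * (vbar + layered_value vbar n p (s - vbar))
     - (lmax - l) * layered_value vbar n p (s + vbar) \<le> l * v + potential vbar n lmin lmax p (s + v)"
proof -
  have "layered_value vbar n p (s + v) - v \<le> vbar + layered_value vbar n p (s - vbar)"
    using layered_value_increment(2)[of "s - vbar" "s + v"] assms by auto
  moreover have "layered_value vbar n p (s + v) \<le> layered_value vbar n p (s + vbar)"
    using layered_value_increment(1)[of "s + v" "s + vbar"] assms by auto
  ultimately have "(l - lmin) * (layered_value vbar n p (s + v) - v)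
       \<le> (l - lmin) * (vbar + layered_value vbar n p (s - vbar))"
     "(lmax - l) * layered_value vbar n p (s + v) \<le> (lmax - l) * layered_value vbar n p (s + vbar)"
    using assms by (auto intro!: mult_left_mono)
  then show ?thesis
    unfolding stage_decomposition by linarith
qed

lemma stage_attained:
  assumes "l = lmin \<or> l = lmax" "s \<in> {0..sbar}"
  shows "l * bang_bang vbar sbar lmax s l
       + potential vbar n lmin lmax p (s + bang_bang vbar sbar lmax s l)
     = - lmin * s - (l - lmin) * (vbar + layered_value vbar n p (s - vbar))
       - (lmax - l) * layered_value vbar n p (s + vbar)"
proof (cases "l = lmax")
  case True
  then have b: "bang_bang vbar sbar lmax s l = - min s vbar"
    by (simp add: bang_bang_def)
  show ?thesis
    unfolding b stage_decomposition using layered_value_sell[of s] assms(2) True by simp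
next
  case False
  then have "bang_bang vbar sbar lmax s l = min vbar (real n * vbar - s)"
    using assms(2) vbar by (simp add: bang_bang_def sbar)
  then show ?thesis
    unfolding stage_decomposition using layered_value_buy[of s] assms(1) False by simp
qed

lemma stage_balance:
  assumes "s \<in> {0..sbar}" "m = lmin + a * (lmax - lmin)"
  shows "- lmin * s - (m - lmin) * (vbar + layered_value vbar n p (s - vbar))
     - (lmax - m) * layered_value vbar n p (s + vbar)
     = potential vbar n lmin lmax p s - vbar * (lmax - lmin) * g"
proof -
  have "lmax - m = (1 - a) * (lmax - lmin)"
    by (simp add: assms(2) algebra_simps)
  then have "(m - lmin) * (vbar + layered_value vbar n p (s - vbar))
      + (lmax - m) * layered_value vbar n p (s + vbar)
      = (lmax - lmin) * (a * (vbar + layered_value vbar n p (s - vbar))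
        + (1 - a) * layered_value vbar n p (s + vbar))"
    by (simp add: assms(2) algebra_simps)
  also have "\<dots> = (lmax - lmin) * (layered_value vbar n p s + g * vbar)"
    using layered_value_balance[of s] assms(1) sbar by simp
  finally show ?thesis
    by (simp add: potential_def algebra_simps)
qed

lemma feasible_bang_bang: "feasible_policy vbar sbar (bang_bang vbar sbar lmax)"
  using vbar by (auto simp: feasible_policy_def bang_bang_def)

text \<open>The stagewise lower bound is affine in \<open>l\<close>, so its expectation depends on \<open>P\<close> only through the
  mean.\<close>

lemma drift_potential_ge:
  assumes P: "set_pmf P \<subseteq> {lmin..lmax}"
    and mean: "measure_pmf.expectation P (\<lambda>l. l) = lmin + a * (lmax - lmin)"
    and feas: "feasible_policy vbar sbar \<pi>" and s: "s \<in> {0..sbar}"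
  shows "- (vbar * (lmax - lmin) * g) \<le> drift P (potential vbar n lmin lmax p) \<pi> s"
proof -
  \<comment> \<open>the bound on the stage cost, affine in the price: \<open>low l = A + C * l\<close>\<close>
  define low where "low l = - lmin * s - (l - lmin) * (vbar + layered_value vbar n p (s - vbar))
     - (lmax - l) * layered_value vbar n p (s + vbar)" for l
  define A where "A = - lmin * s + lmin * (vbar + layered_value vbar n p (s - vbar))
     - lmax * layered_value vbar n p (s + vbar)"
  define C where "C = layered_value vbar n p (s + vbar) - (vbar + layered_value vbar n p (s - vbar))"
  have low: "low l = A + C * l" for l
    by (simp add: low_def A_def C_def algebra_simps)
  have "integrable (measure_pmf P) (\<lambda>l. l)"
    by (rule integrable_measure_pmf_bounded[of _ _ lmax]) (use P lmin in auto)
  then have int: "integrable (measure_pmf P) low"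
    and E: "measure_pmf.expectation P low = low (lmin + a * (lmax - lmin))"
    unfolding low by (simp_all add: mean)
  have "measure_pmf.expectation P low
      \<le> measure_pmf.expectation P (\<lambda>l. l * \<pi> s l + potential vbar n lmin lmax p (s + \<pi> s l))"
  proof (rule integral_mono_AE[OF int])
    show "integrable (measure_pmf P) (\<lambda>l. l * \<pi> s l + potential vbar n lmin lmax p (s + \<pi> s l))"
      using vbar by (intro integrable_stage[OF _ lmin P s feas potential_bounded s]) auto
    show "AE l in measure_pmf P. low l \<le> l * \<pi> s l + potential vbar n lmin lmax p (s + \<pi> s l)"
      unfolding AE_measure_pmf_iff
    proof
      fix l assume "l \<in> set_pmf P"
      with P have l: "l \<in> {lmin..lmax}" by auto
      then have "\<pi> s l \<in> {- vbar..vbar}"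
        using feas s lmin by (auto simp: feasible_policy_def)
      from stage_lower_bound[OF l this]
      show "low l \<le> l * \<pi> s l + potential vbar n lmin lmax p (s + \<pi> s l)"
        by (simp add: low_def)
    qed
  qed
  then show ?thesis
    unfolding E low_def stage_balance[OF s refl] by (simp add: drift_def)
qed

lemma expectation_two_point:
  "measure_pmf.expectation (two_point_pmf lmin lmax a) f = a * f lmax + (1 - a) * f lmin"
  using p by (simp add: two_point_pmf_def layer_prices_def)

lemma drift_potential_bang_bang:
  assumes "s \<in> {0..sbar}"
  shows "drift (two_point_pmf lmin lmax a) (potential vbar n lmin lmax p) (bang_bang vbar sbar lmax) s
    = - (vbar * (lmax - lmin) * g)"
proof -
  define low where "low l = - lmin * s - (l - lmin) * (vbar + layered_value vbar n p (s - vbar))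
     - (lmax - l) * layered_value vbar n p (s + vbar)" for l
  have "measure_pmf.expectation (two_point_pmf lmin lmax a)
      (\<lambda>l. l * bang_bang vbar sbar lmax s l
        + potential vbar n lmin lmax p (s + bang_bang vbar sbar lmax s l))
      = a * low lmax + (1 - a) * low lmin"
    unfolding expectation_two_point low_def using stage_attained[OF _ assms] by simp
  also have "\<dots> = low (lmin + a * (lmax - lmin))"
    by (simp add: low_def algebra_simps)
  also have "\<dots> = potential vbar n lmin lmax p s - vbar * (lmax - lmin) * g"
    unfolding low_def by (rule stage_balance[OF assms refl])
  finally show ?thesis
    by (simp add: drift_def)
qed

lemma average_cost_ge:
  assumes "set_pmf P \<subseteq> {lmin..lmax}"
    and "measure_pmf.expectation P (\<lambda>l. l) = lmin + a * (lmax - lmin)"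
    and "s0 \<in> {0..sbar}" "feasible_policy vbar sbar \<pi>" "has_average_cost (\<lambda>_. P) \<pi> s0 c"
  shows "- (vbar * (lmax - lmin) * g) \<le> c"
proof (rule average_cost_ge_drift[where H = "potential vbar n lmin lmax p",
      OF _ lmin assms(1,3,4) _ _ assms(5)])
  show "0 \<le> vbar" using vbar by simp
qed (rule potential_bounded drift_potential_ge[OF assms(1,2,4)]; assumption)+

text \<open>The idle policy has average cost 0, so the infimum that defines the optimal cost ranges over
  a nonempty set.\<close>

lemma storage_value_le:
  assumes "set_pmf P \<subseteq> {lmin..lmax}"
    and "measure_pmf.expectation P (\<lambda>l. l) = lmin + a * (lmax - lmin)" and "s0 \<in> {0..sbar}"
  shows "storage_value vbar sbar (\<lambda>_. P) s0 \<le> vbar * (lmax - lmin) * g"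
proof -
  have "- (vbar * (lmax - lmin) * g) \<le> optimal_cost vbar sbar (\<lambda>_. P) s0"
    unfolding optimal_cost_def
  proof (rule cInf_greatest)
    have "feasible_policy vbar sbar (\<lambda>_ _. 0)" "has_average_cost (\<lambda>_. P) (\<lambda>_ _. 0) s0 0"
      using vbar by (auto simp: feasible_policy_def has_average_cost_def expected_cost_def)
    then show "{\<gamma>. \<exists>\<pi>. feasible_policy vbar sbar \<pi> \<and> has_average_cost (\<lambda>_. P) \<pi> s0 \<gamma>} \<noteq> {}"
      by blast
  qed (use average_cost_ge[OF assms] in blast)
  then show ?thesis
    by (simp add: storage_value_def)
qed

lemma optimal_cost_two_point:
  assumes "s0 \<in> {0..sbar}"
  shows "optimal_cost vbar sbar (\<lambda>_. two_point_pmf lmin lmax a) s0 = - (vbar * (lmax - lmin) * g)"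
  unfolding optimal_cost_def
proof (rule cInf_eq_minimum)
  have "has_average_cost (\<lambda>_. two_point_pmf lmin lmax a) (bang_bang vbar sbar lmax) s0
      (- (vbar * (lmax - lmin) * g))"
  proof (rule average_cost_eq_drift[where H = "potential vbar n lmin lmax p",
        OF _ lmin set_two_point_pmf[OF le] assms feasible_bang_bang])
    show "0 \<le> vbar" using vbar by simp
  qed (rule potential_bounded drift_potential_bang_bang; assumption)+
  then show "- (vbar * (lmax - lmin) * g) \<in> {\<gamma>. \<exists>\<pi>. feasible_policy vbar sbar \<pi>
      \<and> has_average_cost (\<lambda>_. two_point_pmf lmin lmax a) \<pi> s0 \<gamma>}"
    using feasible_bang_bang by blast
next
  have "measure_pmf.expectation (two_point_pmf lmin lmax a) (\<lambda>l. l) = lmin + a * (lmax - lmin)"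
    by (simp add: expectation_two_point algebra_simps)
  then show "- (vbar * (lmax - lmin) * g) \<le> c" if "c \<in> {\<gamma>. \<exists>\<pi>. feasible_policy vbar sbar \<pi>
      \<and> has_average_cost (\<lambda>_. two_point_pmf lmin lmax a) \<pi> s0 \<gamma>}" for c
    using average_cost_ge[OF set_two_point_pmf[OF le] _ assms] that by blast
qed

text \<open>The function \<open>K\<close> only has to agree with the potential up to a constant on the state space,
  so that it can be given by a closed formula.\<close>

lemma bellman_potential:
  assumes K: "\<And>s. s \<in> {0..sbar} \<Longrightarrow> K s = potential vbar n lmin lmax p s + c"
  shows "bellman vbar sbar (two_point_pmf lmin lmax a) (- (vbar * (lmax - lmin) * g)) K"
  unfolding bellman_def
proof (intro ballI conjI)
  fix s assume s: "s \<in> {0..sbar}"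
  define u where "u l = bang_bang vbar sbar lmax s l" for l
  have u: "u l \<in> feasible_controls vbar sbar s" for l
    using s vbar by (auto simp: feasible_controls_def u_def bang_bang_def)
  have next_state: "s + w \<in> {0..sbar}" "w \<in> {- vbar..vbar}"
    if "w \<in> feasible_controls vbar sbar s" for w
    using that by (auto simp: feasible_controls_def)
  have supp: "l = lmin \<or> l = lmax" "l \<in> {lmin..lmax}"
    if "l \<in> set_pmf (two_point_pmf lmin lmax a)" for l
    using that le by (auto simp: two_point_pmf_def split: if_splits)
  have opt: "l * u l + K (s + u l) \<le> l * w + K (s + w)"
    if "l \<in> set_pmf (two_point_pmf lmin lmax a)" "w \<in> feasible_controls vbar sbar s" for l w
    using stage_lower_bound[OF supp(2)[OF that(1)] next_state(2)[OF that(2)], of s]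
      stage_attained[OF supp(1)[OF that(1)] s, folded u_def]
    unfolding K[OF next_state(1)[OF u]] K[OF next_state(1)[OF that(2)]] by linarith
  show "\<exists>v\<in>feasible_controls vbar sbar s. \<forall>w\<in>feasible_controls vbar sbar s.
      l * v + K (s + v) \<le> l * w + K (s + w)"
    if "l \<in> set_pmf (two_point_pmf lmin lmax a)" for l
    using opt[OF that] u by blast
  have "measure_pmf.expectation (two_point_pmf lmin lmax a)
      (\<lambda>l. INF v\<in>feasible_controls vbar sbar s. l * v + K (s + v))
      = measure_pmf.expectation (two_point_pmf lmin lmax a)
          (\<lambda>l. (l * u l + potential vbar n lmin lmax p (s + u l)) + c)"
  proof (rule expectation_cong_pmf)
    fix l assume l: "l \<in> set_pmf (two_point_pmf lmin lmax a)"
    have "(INF v\<in>feasible_controls vbar sbar s. l * v + K (s + v)) = l * u l + K (s + u l)"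
      by (rule cInf_eq_minimum) (use opt[OF l] u in auto)
    then show "(INF v\<in>feasible_controls vbar sbar s. l * v + K (s + v))
        = (l * u l + potential vbar n lmin lmax p (s + u l)) + c"
      using next_state[OF u] by (simp add: K)
  qed
  also have "\<dots> = measure_pmf.expectation (two_point_pmf lmin lmax a)
      (\<lambda>l. l * u l + potential vbar n lmin lmax p (s + u l)) + c"
    by (simp add: expectation_two_point algebra_simps)
  also have "\<dots> = K s - vbar * (lmax - lmin) * g"
    using drift_potential_bang_bang[OF s] unfolding K[OF s] drift_def u_def by linarith
  finally show "K s = measure_pmf.expectation (two_point_pmf lmin lmax a)
      (\<lambda>l. INF v\<in>feasible_controls vbar sbar s. l * v + K (s + v)) - - (vbar * (lmax - lmin) * g)"
    by simp
qed

end

end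

section \<open>Solving for the layer prices\<close>

text \<open>With \<open>S k\<close> the geometric sum of \<open>k\<close> terms, \<open>p j = S (n + 1 - j) / S (n + 1)\<close>, and the
  recursion for \<open>p\<close> is \<open>S (k + 1) = 1 + b * S k\<close>.\<close>

lemma layer_prices_geometric:
  fixes a b :: real
  assumes "0 < a" "a \<le> 1" "b = (1 - a) / a"
  shows "layer_prices n a (b * (\<Sum>i<n. b ^ i) / ((b + 1) * (\<Sum>i\<le>n. b ^ i)))
    (\<lambda>j. (\<Sum>i<Suc n - j. b ^ i) / (\<Sum>i\<le>n. b ^ i))"
proof -
  define S where "S k = (\<Sum>i<k. b ^ i)" for k
  have b: "0 \<le> b"
    using assms by simp
  have "b + 1 = 1 / a"
    using assms by (simp add: diff_divide_distrib)
  then have a: "a = 1 / (b + 1)" by simp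
  have S_Suc: "S (Suc k) = 1 + b * S k" for k
    unfolding S_def sum.lessThan_Suc_shift by (simp add: sum_distrib_left)
  have S_nonneg: "0 \<le> S k" for k
    using b by (simp add: S_def sum_nonneg)
  have S_pos: "0 < S (Suc k)" for k
    unfolding S_Suc using b S_nonneg[of k] by (simp add: add_pos_nonneg)
  have S_mono: "S j \<le> S k" if "j \<le> k" for j k
    unfolding S_def by (intro sum_mono2) (use that b in auto)
  have "a * (1 - S (Suc n - i) / S (Suc n)) + (1 - a) * (S (Suc n - Suc i) / S (Suc n))
      = b * S n / ((b + 1) * S (Suc n))" if "i \<le> n" for i
  proof -
    have "S (Suc n) - S (Suc n - i) = b * S n - b * S (n - i)"
      using that by (simp add: Suc_diff_le S_Suc)
    then have 1: "1 - S (Suc n - i) / S (Suc n) = (b * S n - b * S (n - i)) / S (Suc n)"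
      using S_pos[of n] by (simp add: diff_divide_distrib[of "S (Suc n)", symmetric] field_simps)
    have 2: "1 - a = b / (b + 1)"
      using b by (simp add: a field_simps)
    show ?thesis
      unfolding 1 2 by (simp add: a add_divide_distrib[symmetric])
  qed
  moreover have "S (Suc n - i) \<le> S (Suc n)" for i
    by (rule S_mono) simp
  moreover have "(\<Sum>i\<le>n. b ^ i) = S (Suc n)" "S 0 = 0"
    by (simp_all add: S_def lessThan_Suc_atMost)
  ultimately show ?thesis
    using assms(1,2) S_pos[of n] S_nonneg unfolding layer_prices_def S_def[symmetric] by simp
qed

text \<open>With \<open>T = b + b^2 + ... + b^n\<close> the denominator is \<open>1 + b^(n+1) + 2 * T\<close>, so the claim says
  \<open>2 * T \<le> n * (1 + b^(n+1))\<close>. It follows by pairing \<open>b^j\<close> with \<open>b^(n+1-j)\<close>: the product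
  \<open>(1 - b^j) * (1 - b^(n+1-j))\<close> is nonnegative because both factors have the same sign.\<close>

lemma geometric_gain_le:
  fixes b :: real
  assumes b: "0 \<le> b"
  shows "b * (\<Sum>i<n. b ^ i) / ((b + 1) * (\<Sum>i\<le>n. b ^ i)) \<le> real n / (2 * (real n + 1))"
proof -
  define T where "T = b * (\<Sum>i<n. b ^ i)"
  have T: "T = (\<Sum>i<n. b ^ Suc i)"
    by (simp add: T_def sum_distrib_left)
  have S: "(\<Sum>i\<le>n. b ^ i) = 1 + T"
    unfolding T by (simp add: sum.atMost_shift)
  have S': "(b + 1) * (\<Sum>i\<le>n. b ^ i) = 1 + b ^ Suc n + 2 * T"
  proof -
    have "(b + 1) * (\<Sum>i\<le>n. b ^ i) = (\<Sum>i\<le>n. b ^ Suc i) + (\<Sum>i\<le>n. b ^ i)"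
      by (simp add: distrib_right sum_distrib_left sum.distrib)
    also have "(\<Sum>i\<le>n. b ^ Suc i) = T + b ^ Suc n"
      by (simp only: T lessThan_Suc_atMost[symmetric] sum.lessThan_Suc)
    finally show ?thesis by (simp add: S)
  qed
  have rev: "T = (\<Sum>i<n. b ^ (n - i))"
    unfolding T by (subst sum.nat_diff_reindex[symmetric]) (auto intro!: sum.cong simp: Suc_diff_Suc)
  have pair: "b ^ Suc i + b ^ (n - i) \<le> 1 + b ^ Suc n" if "i < n" for i
  proof -
    have "0 \<le> (1 - b ^ Suc i) * (1 - b ^ (n - i))"
    proof (cases "b \<le> 1")
      case True
      then show ?thesis
        using b by (intro mult_nonneg_nonneg) (auto intro: power_le_one simp del: power_Suc)
    next
      case False
      then show ?thesis
        by (intro mult_nonpos_nonpos) (auto intro: one_le_power simp del: power_Suc)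
    qed
    moreover have "b ^ Suc i * b ^ (n - i) = b ^ Suc n"
      using that unfolding power_add[symmetric] by simp
    ultimately show ?thesis by (simp add: algebra_simps del: power_Suc)
  qed
  have "2 * T = (\<Sum>i<n. b ^ Suc i + b ^ (n - i))"
    by (subst sum.distrib) (simp only: T[symmetric] rev[symmetric])
  also have "\<dots> \<le> (\<Sum>i<n. 1 + b ^ Suc n)"
    by (intro sum_mono pair) auto
  finally have le: "2 * T \<le> real n * (1 + b ^ Suc n)" by simp
  have "0 \<le> T" unfolding T using b by (intro sum_nonneg) auto
  moreover have "0 \<le> b ^ Suc n" using b by simp
  ultimately have pos: "0 < 1 + b ^ Suc n + 2 * T" by linarith
  show ?thesis
    unfolding S' T_def[symmetric] using pos le
    by (simp add: divide_simps del: power_Suc) (simp add: algebra_simps del: power_Suc)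
qed

text \<open>For \<open>a = 0\<close> the ratio \<open>b\<close> is infinite. The limiting solution gives every physical layer the
  price 0: when all prices are \<open>lmin\<close>, storage earns nothing.\<close>

lemma layer_prices_exist:
  assumes "0 \<le> a" "a \<le> 1"
  obtains g p where "layer_prices n a g p" "g \<le> real n / (2 * (real n + 1))"
proof (cases "a = 0")
  case True
  have "layer_prices n a 0 (\<lambda>j. if j = 0 then 1 else 0)"
    by (simp add: layer_prices_def True)
  then show thesis by (rule that) simp
next
  case False
  with assms have "0 < a" by simp
  show thesis
    by (rule that[OF layer_prices_geometric[OF \<open>0 < a\<close> assms(2) refl]], rule geometric_gain_le)
      (use \<open>0 < a\<close> assms in simp)
qed

lemma mean_as_mixture:
  assumes P: "set_pmf P \<subseteq> {lmin..lmax :: real}" and "lmin \<le> lmax"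
  obtains a where "0 \<le> a" "a \<le> 1" "measure_pmf.expectation P (\<lambda>l. l) = lmin + a * (lmax - lmin)"
proof -
  let ?m = "measure_pmf.expectation P (\<lambda>l. l)"
  have int: "integrable (measure_pmf P) (\<lambda>l. l)"
    by (rule integrable_measure_pmf_bounded[of _ _ "\<bar>lmin\<bar> + \<bar>lmax\<bar>"]) (use P in force)
  have m: "lmin \<le> ?m" "?m \<le> lmax"
    by (intro measure_pmf.integral_ge_const measure_pmf.integral_le_const int;
        use P in \<open>auto simp: AE_measure_pmf_iff\<close>)+
  show thesis
  proof (cases "lmin = lmax")
    case True
    then show thesis using that[of 0] m by simp
  next
    case False
    then show thesis
      using that[of "(?m - lmin) / (lmax - lmin)"] m assms(2) by simp
  qed
qed

section \<open>The differential cost of the symmetric distribution\<close>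

text \<open>With closed intervals the top state lies in the last piece like its neighbours, so later
  arguments need not single it out.\<close>

lemma diff_cost_locate:
  assumes "0 < vbar" "1 \<le> n" "s \<in> {0..real n * vbar}"
  obtains i where "i < n" "s \<in> {real i * vbar..(real i + 1) * vbar}"
    "diff_cost n vbar lmin lmax s = diff_cost_piece n vbar lmin lmax i s"
proof -
  define k where "k = nat \<lfloor>s / vbar\<rfloor>"
  have k: "real k \<le> s / vbar" "s / vbar < real k + 1"
    using assms(1,3) by (auto simp: k_def)
  have kn: "k \<le> n"
  proof -
    have "s / vbar \<le> real n" using assms(1,3) by (simp add: field_simps)
    with k(1) show ?thesis by linarith
  qed
  have r: "real k * vbar \<le> s" "s \<le> (real k + 1) * vbar"
    using k assms(1) by (auto simp: field_simps)
  show thesis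
  proof (cases "k = n")
    case True
    then show thesis
      using that[of "n - 1"] assms r
      by (auto simp: diff_cost_def k_def[symmetric] of_nat_diff algebra_simps)
  next
    case False
    with kn have "k < n" "min k (n - 1) = k" by simp_all
    then show thesis
      using that[of k] r by (simp add: diff_cost_def k_def[symmetric])
  qed
qed

lemma diff_cost_piece_diff:
  "diff_cost_piece n vbar lmin lmax i s - diff_cost_piece n vbar lmin lmax j s
     = (lmax - lmin) / (real n + 1) * (real i - real j) * (s - (real i + real j + 1) / 2 * vbar)"
proof -
  define e where "e = 1 / (real n + 1)"
  have piece: "diff_cost_piece n vbar lmin lmax k s
      = e * (- ((real k + 1) * lmin + (real n - real k) * lmax) * s
             - real k * (real k + 1) * (lmax - lmin) * vbar / 2)" for k
    by (simp add: diff_cost_piece_def e_def right_diff_distrib)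
  have slope: "(lmax - lmin) / (real n + 1) = e * (lmax - lmin)"
    by (simp add: e_def)
  show ?thesis
    unfolding piece slope by (simp add: algebra_simps add_divide_distrib diff_divide_distrib)
qed

text \<open>As a function of the index \<open>j\<close> the pieces form a concave parabola at each \<open>s\<close>, so the piece
  that belongs to \<open>s\<close> is the largest one.\<close>

lemma diff_cost_piece_le:
  assumes "0 < vbar" "1 \<le> n" "s \<in> {0..real n * vbar}" "lmin \<le> lmax"
  shows "diff_cost_piece n vbar lmin lmax j s \<le> diff_cost n vbar lmin lmax s"
proof -
  from diff_cost_locate[OF assms(1-3)] obtain i
    where i: "s \<in> {real i * vbar..(real i + 1) * vbar}"
      and eq: "diff_cost n vbar lmin lmax s = diff_cost_piece n vbar lmin lmax i s" by metis
  have "0 \<le> (real i - real j) * (s - (real i + real j + 1) / 2 * vbar)"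
  proof (cases i j rule: linorder_cases)
    case less
    then have "(real i + 1) * vbar \<le> (real i + real j + 1) / 2 * vbar"
      using assms(1) by (intro mult_right_mono) auto
    then show ?thesis
      using less i by (intro mult_nonpos_nonpos) auto
  next
    case greater
    then have "(real i + real j + 1) / 2 * vbar \<le> real i * vbar"
      using assms(1) by (intro mult_right_mono) auto
    then show ?thesis
      using greater i by (intro mult_nonneg_nonneg) auto
  qed simp
  then have "0 \<le> (lmax - lmin) / (real n + 1)
      * ((real i - real j) * (s - (real i + real j + 1) / 2 * vbar))"
    using assms(4) by simp
  then show ?thesis
    using diff_cost_piece_diff[of n vbar lmin lmax i s j] by (simp add: eq mult.assoc)
qed

lemma convex_on_diff_cost:
  assumes "0 < vbar" "1 \<le> n" "lmin \<le> lmax"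
  shows "convex_on {0..real n * vbar} (diff_cost n vbar lmin lmax)"
proof (rule convex_onI)
  fix t x y :: real
  assume t: "0 < t" "t < 1" and x: "x \<in> {0..real n * vbar}" and y: "y \<in> {0..real n * vbar}"
  let ?z = "(1 - t) *\<^sub>R x + t *\<^sub>R y"
  have "?z \<in> {0..real n * vbar}"
    using t by (intro convexD_alt[OF convex_real_interval(5) x y]) auto
  from diff_cost_locate[OF assms(1,2) this] obtain i
    where eq: "diff_cost n vbar lmin lmax ?z = diff_cost_piece n vbar lmin lmax i ?z" by metis
  also have "\<dots> = (1 - t) * diff_cost_piece n vbar lmin lmax i x
      + t * diff_cost_piece n vbar lmin lmax i y"
  proof -
    have "c * ((1 - t) * x + t * y) - d = (1 - t) * (c * x - d) + t * (c * y - d)" for c d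
      by (simp add: algebra_simps)
    then show ?thesis
      unfolding diff_cost_piece_def real_scaleR_def by blast
  qed
  also have "\<dots> \<le> (1 - t) * diff_cost n vbar lmin lmax x + t * diff_cost n vbar lmin lmax y"
    using t diff_cost_piece_le[OF assms(1,2) x assms(3)] diff_cost_piece_le[OF assms(1,2) y assms(3)]
    by (intro add_mono mult_left_mono) auto
  finally show "diff_cost n vbar lmin lmax ?z
      \<le> (1 - t) * diff_cost n vbar lmin lmax x + t * diff_cost n vbar lmin lmax y" .
qed (simp add: convex_real_interval)

lemma layer_prices_symmetric:
  "layer_prices n (1/2) (real n / (2 * (real n + 1))) (\<lambda>j. real (Suc n - j) / (real n + 1))"
  using layer_prices_geometric[of "1/2" 1 n] by (simp add: add.commute)

text \<open>The slope of piece \<open>i\<close> is \<open>-(lmin + D * p (i + 1))\<close> with \<open>D = lmax - lmin\<close>. The constant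
  \<open>D * vbar\<close> is the value of the fictitious layer 0, which is full in the empty
  store.\<close>

lemma diff_cost_eq_potential:
  assumes "0 < vbar" "1 \<le> n" "s \<in> {0..real n * vbar}"
  shows "diff_cost n vbar lmin lmax s
    = potential vbar n lmin lmax (\<lambda>j. real (Suc n - j) / (real n + 1)) s + (lmax - lmin) * vbar"
proof -
  let ?p = "\<lambda>j. real (Suc n - j) / (real n + 1)"
  from diff_cost_locate[OF assms] obtain i
    where i: "i < n" "s \<in> {real i * vbar..(real i + 1) * vbar}"
      and eq: "diff_cost n vbar lmin lmax s = diff_cost_piece n vbar lmin lmax i s" by metis
  have "(\<Sum>j\<le>k. ?p j) = (real k + 1) * (1 - real k / (2 * (real n + 1)))" if "k \<le> n" for k
    using that
  proof (induction k)
    case (Suc k)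
    then have "(\<Sum>j\<le>k. ?p j) = (real k + 1) * (1 - real k / (2 * (real n + 1)))" by simp
    then show ?case
      unfolding sum.atMost_Suc using Suc.prems
      by (simp only:) (simp add: of_nat_diff divide_simps, simp add: algebra_simps)
  qed simp
  then have V: "layered_value vbar n ?p s
      = vbar * ((real i + 1) * (1 - real i / (2 * (real n + 1))))
        + (real n - real i) / (real n + 1) * (s - real i * vbar)"
    using layered_value_piece[OF assms(1) layer_prices_symmetric i] i(1) by (simp add: of_nat_diff)
  define e where "e = 1 / (2 * (real n + 1))"
  have e: "2 * (real n + 1) * e = 1"
    by (simp add: e_def)
  have e2: "2 * e = 1 / (real n + 1)"
    by (simp add: e_def divide_simps)
  have "layered_value vbar n ?p s = vbar * ((real i + 1) * (1 - real i * e))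
      + (real n - real i) * (2 * e) * (s - real i * vbar)"
    unfolding V e2 by (simp add: e_def)
  moreover have "diff_cost_piece n vbar lmin lmax i s
      = - ((real i + 1) * lmin + (real n - real i) * lmax) * (2 * e) * s
        - real i * (real i + 1) * (lmax - lmin) * vbar * e"
    unfolding diff_cost_piece_def e2 by (simp add: e_def)
  ultimately show ?thesis
    unfolding eq potential_def using e by algebra
qed

section \<open>The long-term value of storage\<close>

theorem theorem2:
  fixes vbar sbar lmin lmax s0 :: real and n :: nat
  assumes "vbar > 0" and "n \<ge> 1" and "sbar = real n * vbar"
    and "0 \<le> lmin" and "lmin \<le> lmax"
    and "s0 \<in> {0..sbar}"
  shows
    "((\<forall>P. set_pmf P \<subseteq> {lmin..lmax} \<longrightarrow>
          storage_value vbar sbar (\<lambda>_. P) s0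
            \<le> vbar * (lmax - lmin) / 2 * (real n / (real n + 1))) \<and>
      storage_value vbar sbar (\<lambda>_. two_point_pmf lmin lmax (1/2)) s0
        = vbar * (lmax - lmin) / 2 * (real n / (real n + 1)) \<and>
      vbar * (lmax - lmin) / 2 * (real n / (real n + 1))
        = (lmax - lmin) / 2 * (sbar * vbar / (sbar + vbar)))
     \<and>
     (bellman vbar sbar (two_point_pmf lmin lmax (1/2))
        (optimal_cost vbar sbar (\<lambda>_. two_point_pmf lmin lmax (1/2)) s0)
        (diff_cost n vbar lmin lmax) \<and>
      convex_on {0..sbar} (diff_cost n vbar lmin lmax))
     \<and>
     (\<forall>a b. 0 < a \<and> a \<le> 1 \<and> b = (1 - a) / a \<longrightarrow>
        storage_value vbar sbar (\<lambda>_. two_point_pmf lmin lmax a) s0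
          = vbar * (lmax - lmin) * (b * (\<Sum>i<n. b ^ i) / ((b + 1) * (\<Sum>i\<le>n. b ^ i))))"
proof -
  have gain: "vbar * (lmax - lmin) / 2 * (real n / (real n + 1))
      = vbar * (lmax - lmin) * (real n / (2 * (real n + 1)))"
    by (simp add: field_simps)
  have upper: "storage_value vbar sbar (\<lambda>_. P) s0 \<le> vbar * (lmax - lmin) / 2 * (real n / (real n + 1))"
    if P: "set_pmf P \<subseteq> {lmin..lmax}" for P
  proof -
    obtain a where a: "0 \<le> a" "a \<le> 1"
      "measure_pmf.expectation P (\<lambda>l. l) = lmin + a * (lmax - lmin)"
      using mean_as_mixture[OF P assms(5)] .
    obtain g p where g: "layer_prices n a g p" "g \<le> real n / (2 * (real n + 1))"
      using layer_prices_exist[OF a(1,2)] .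
    have "storage_value vbar sbar (\<lambda>_. P) s0 \<le> vbar * (lmax - lmin) * g"
      by (rule storage_value_le[OF assms(1) g(1) assms(4,5,3) P a(3) assms(6)])
    also have "\<dots> \<le> vbar * (lmax - lmin) * (real n / (2 * (real n + 1)))"
      using g(2) assms(1,5) by (intro mult_left_mono) auto
    finally show ?thesis unfolding gain .
  qed
  note sym = optimal_cost_two_point[OF assms(1) layer_prices_symmetric assms(4,5,3,6)]
  have value_sym: "storage_value vbar sbar (\<lambda>_. two_point_pmf lmin lmax (1/2)) s0
      = vbar * (lmax - lmin) / 2 * (real n / (real n + 1))"
    unfolding storage_value_def sym gain by simp
  have closed_form: "vbar * (lmax - lmin) / 2 * (real n / (real n + 1))
      = (lmax - lmin) / 2 * (sbar * vbar / (sbar + vbar))"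
  proof -
    have "sbar * vbar / (sbar + vbar) = vbar * (real n * vbar) / (vbar * (real n + 1))"
      by (simp add: assms(3) algebra_simps)
    also have "\<dots> = vbar * (real n / (real n + 1))"
      using assms(1) by simp
    finally show ?thesis by simp
  qed
  have bellman: "bellman vbar sbar (two_point_pmf lmin lmax (1/2))
      (optimal_cost vbar sbar (\<lambda>_. two_point_pmf lmin lmax (1/2)) s0) (diff_cost n vbar lmin lmax)"
    unfolding sym
    by (rule bellman_potential[OF assms(1) layer_prices_symmetric assms(4,5,3)
          diff_cost_eq_potential[OF assms(1,2)]]) (simp add: assms(3))
  have value_a: "storage_value vbar sbar (\<lambda>_. two_point_pmf lmin lmax a) s0
      = vbar * (lmax - lmin) * (b * (\<Sum>i<n. b ^ i) / ((b + 1) * (\<Sum>i\<le>n. b ^ i)))"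
    if "0 < a" "a \<le> 1" "b = (1 - a) / a" for a b
    using optimal_cost_two_point[OF assms(1) layer_prices_geometric[OF that] assms(4,5,3,6)]
    unfolding storage_value_def by linarith
  have convex: "convex_on {0..sbar} (diff_cost n vbar lmin lmax)"
    unfolding assms(3) by (rule convex_on_diff_cost[OF assms(1,2,5)])
  show ?thesis
    by (intro conjI allI impI; (elim conjE)?;
        (rule upper value_sym closed_form bellman convex value_a | assumption)+)
qed

end
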